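(* Let $X$ be a nontrivial complex Banach space and let $A(\Omega,X)$ be an $X$-valued function space over a base (function) algebra $A$ on a Hausdorff space $\Omega$. Let $M_A$ be the maximal ideal space of $A$ with the Gelfand topology (a compact Hausdorff space). Then $A(\Omega,X)$ is isometrically isomorphic to an $(X^{**},w^* )$-valued function space on the compact Hausdorff space $M_A$ over the base algebra $\hat A=\{\hat f: f\in A\}$, the image of $A$ under the Gelfand transform.
   Context: For a Hausdorff space $\Omega$, $C_b(\Omega)$ is the Banach algebra of bounded complex-valued continuous functions on $\Omega$ with the supremum norm; a function algebra on $\Omega$ is a closed subalgebra of $C_b(\Omega)$ that separates the points of $\Omega$ and contains the constant functions (if $\Omega$ is compact it is called a uniform algebra). $C_b(\Omega,X)$ is the Banach space of bounded norm-continuous functions $\Omega\to X$ with the supremum norm. An $X$-valued function space over a function algebra on $\Omega$, denoted $A(\Omega,X)$, is a closed subspace of $C_b(\Omega,X)$ such that (i) the base algebra $A:=\{x^*\circ f: f\in A(\Omega,X),\ x^*\in X^*\}$ is a function algebra on $\Omega$; and (ii) $fg\in A(\Omega,X)$ for every $f\in A$ and $g\in A(\Omega,X)$. $M_A$ is the set of all nonzero algebra homomorphisms $A\to\mathbb{C}$ with the Gelfand topology; the Gelfand transform of $f\in A$ is $\hat f:M_A\to\mathbb{C}$, $\hat f(\phi)=\phi(f)$. For a compact Hausdorff space $M$, $C(M,(X^{**},w^* ))$ is the Banach space of continuous functions $h:M\to (X^{**},w^* )$ with norm $\|h\|=\sup_{s\in M}\|h(s)\|_{X^{**}}$. An $(X^{**},w^*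 )$-valued function space on $M$ over a uniform algebra is a closed subspace $E$ of $C(M,(X^{**},w^* ))$ such that (i) its base algebra $B:=\{x^*\circ h: h\in E,\ x^*\in X^*=(X^{**},w^* )^*\}$ (where $(x^*\circ h)(s)=h(s)(x^* )$) is a uniform algebra on $M$; and (ii) $\phi h\in E$ for all $\phi\in B$ and $h\in E$. *)

theory Defs
  imports "HOL-Analysis.Analysis"
begin

section \<open>Complex normed and Banach spaces\<close>

class complex_normed_vector = real_normed_vector +
  fixes scaleC :: "complex \<Rightarrow> 'a \<Rightarrow> 'a"  (infixr \<open>*\<^sub>C\<close> 75)
  assumes scaleC_add_right: "c *\<^sub>C (x + y) = c *\<^sub>C x + c *\<^sub>C y"
    and scaleC_add_left: "(c + d) *\<^sub>C x = c *\<^sub>C x + d *\<^sub>C x"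
    and scaleC_scaleC: "c *\<^sub>C d *\<^sub>C x = (c * d) *\<^sub>C x"
    and scaleC_of_real: "complex_of_real r *\<^sub>C x = r *\<^sub>R x"
    and norm_scaleC: "norm (c *\<^sub>C x) = cmod c * norm x"

class complex_banach = complex_normed_vector + banach

instantiation complex :: complex_banach
begin

definition scaleC_complex :: "complex \<Rightarrow> complex \<Rightarrow> complex"
  where "scaleC_complex c x = c * x"

instance
  by standard (auto simp: scaleC_complex_def algebra_simps norm_mult scaleR_conv_of_real)

end


section \<open>The dual of a complex normed space\<close>

text \<open>Bounded complex-linear functionals. The norm is inherited from \<^typ>\<open>'a \<Rightarrow>\<^sub>L complex\<close>,
  so it is the operator norm.\<close>

typedef (overloaded) 'a cdual =
  "{f :: 'a::complex_normed_vector \<Rightarrow>\<^sub>L complex. \<forall>c x. blinfun_apply f (c *\<^sub>C x) = c * blinfun_apply f x}"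
  by (rule exI[of _ 0]) simp

setup_lifting type_definition_cdual

lift_definition cdual_apply :: "'a::complex_normed_vector cdual \<Rightarrow> 'a \<Rightarrow> complex"
  is blinfun_apply .

instantiation cdual :: (complex_normed_vector) complex_normed_vector
begin

lift_definition norm_cdual :: "'a cdual \<Rightarrow> real" is norm .

lift_definition zero_cdual :: "'a cdual" is 0
  by simp

lift_definition plus_cdual :: "'a cdual \<Rightarrow> 'a cdual \<Rightarrow> 'a cdual" is "(+)"
  by (simp add: blinfun.add_left algebra_simps)

lift_definition minus_cdual :: "'a cdual \<Rightarrow> 'a cdual \<Rightarrow> 'a cdual" is "(-)"
  by (simp add: blinfun.diff_left algebra_simps)

lift_definition uminus_cdual :: "'a cdual \<Rightarrow> 'a cdual" is uminus
  by (simp add: blinfun.minus_left)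

lift_definition scaleR_cdual :: "real \<Rightarrow> 'a cdual \<Rightarrow> 'a cdual" is scaleR
  by (simp add: blinfun.scaleR_left algebra_simps scaleR_conv_of_real)

lift_definition scaleC_cdual :: "complex \<Rightarrow> 'a cdual \<Rightarrow> 'a cdual"
  is "\<lambda>c f. blinfun_mult_right c o\<^sub>L f"
  by (simp add: algebra_simps)

definition dist_cdual :: "'a cdual \<Rightarrow> 'a cdual \<Rightarrow> real"
  where "dist_cdual f g = norm (f - g)"

definition uniformity_cdual :: "('a cdual \<times> 'a cdual) filter"
  where "uniformity_cdual = (INF e\<in>{0 <..}. principal {(x, y). dist x y < e})"

definition open_cdual :: "'a cdual set \<Rightarrow> bool"
  where "open_cdual S = (\<forall>x\<in>S. \<forall>\<^sub>F (x', y) in uniformity. x' = x \<longrightarrow> y \<in> S)"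

definition sgn_cdual :: "'a cdual \<Rightarrow> 'a cdual"
  where "sgn_cdual x = inverse (norm x) *\<^sub>R x"

instance
proof
  fix f g :: "'a cdual" and c d :: complex and r :: real
  show "c *\<^sub>C (f + g) = c *\<^sub>C f + c *\<^sub>C g"
    by transfer (rule blinfun_eqI, simp add: blinfun.add_left algebra_simps)
  show "(c + d) *\<^sub>C f = c *\<^sub>C f + d *\<^sub>C f"
    by transfer (rule blinfun_eqI, simp add: blinfun.add_left algebra_simps)
  show "c *\<^sub>C d *\<^sub>C f = (c * d) *\<^sub>C f"
    by transfer (rule blinfun_eqI, simp add: algebra_simps)
  show "complex_of_real r *\<^sub>C f = r *\<^sub>R f"
    by transfer (rule blinfun_eqI, simp add: blinfun.scaleR_left scaleR_conv_of_real)
  show "norm (c *\<^sub>C f) = cmod c * norm f"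
  proof transfer
    fix c and f :: "'a \<Rightarrow>\<^sub>L complex"
    have le: "norm (blinfun_mult_right c o\<^sub>L f) \<le> cmod c * norm f" for c and f :: "'a \<Rightarrow>\<^sub>L complex"
      by (rule norm_blinfun_bound)
        (auto simp: norm_mult mult.assoc intro!: mult_left_mono norm_blinfun)
    show "norm (blinfun_mult_right c o\<^sub>L f) = cmod c * norm f"
    proof (cases "c = 0")
      case True
      then have "blinfun_mult_right c o\<^sub>L f = 0"
        by (intro blinfun_eqI) simp
      with True show ?thesis by simp
    next
      case False
      have "f = blinfun_mult_right (inverse c) o\<^sub>L (blinfun_mult_right c o\<^sub>L f)"
        by (intro blinfun_eqI) (simp add: False)
      then have "norm f \<le> cmod (inverse c) * norm (blinfun_mult_right c o\<^sub>L f)"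
        by (metis le)
      then have "cmod c * norm f \<le> cmod c * (cmod (inverse c) * norm (blinfun_mult_right c o\<^sub>L f))"
        by (intro mult_left_mono) auto
      also have "\<dots> = norm (blinfun_mult_right c o\<^sub>L f)"
        using False by (simp add: norm_inverse)
      finally have "cmod c * norm f \<le> norm (blinfun_mult_right c o\<^sub>L f)" .
      with le[of c f] show ?thesis by simp
    qed
  qed
qed (unfold dist_cdual_def open_cdual_def sgn_cdual_def uniformity_cdual_def,
    (rule refl | (transfer, simp add: algebra_simps norm_triangle_ineq))+)

end

lemma dist_Rep_cdual: "dist (Rep_cdual f) (Rep_cdual g) = dist f g"
  by (simp add: dist_cdual_def dist_norm norm_cdual.rep_eq minus_cdual.rep_eq)

instance cdual :: (complex_normed_vector) complex_banach
proof
  fix X :: "nat \<Rightarrow> 'a cdual"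
  assume "Cauchy X"
  then have "Cauchy (\<lambda>n. Rep_cdual (X n))"
    by (simp add: Cauchy_def dist_Rep_cdual)
  then obtain L where L: "(\<lambda>n. Rep_cdual (X n)) \<longlonglongrightarrow> L"
    using Cauchy_convergent convergent_def by blast
  have app: "(\<lambda>n. blinfun_apply (Rep_cdual (X n)) x) \<longlonglongrightarrow> blinfun_apply L x" for x
    using L by (intro tendsto_intros)
  have "blinfun_apply L (c *\<^sub>C x) = c * blinfun_apply L x" for c x
  proof -
    have "(\<lambda>n. c * blinfun_apply (Rep_cdual (X n)) x) \<longlonglongrightarrow> c * blinfun_apply L x"
      by (intro tendsto_intros app)
    moreover have "(\<lambda>n. c * blinfun_apply (Rep_cdual (X n)) x)
        = (\<lambda>n. blinfun_apply (Rep_cdual (X n)) (c *\<^sub>C x))"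
      using Rep_cdual[of "X n" for n] by simp
    ultimately show ?thesis
      using app LIMSEQ_unique by metis
  qed
  then have "L = Rep_cdual (Abs_cdual L)"
    by (simp add: Abs_cdual_inverse)
  then have "X \<longlonglongrightarrow> Abs_cdual L"
    using L unfolding lim_sequentially by (metis dist_Rep_cdual)
  then show "convergent X"
    by (rule convergentI)
qed

lemma norm_cdual_apply_le: "cmod (cdual_apply f x) \<le> norm f * norm x"
  by transfer (rule norm_blinfun)

lemma norm_cdual_bound:
  "0 \<le> b \<Longrightarrow> (\<And>x. cmod (cdual_apply f x) \<le> b * norm x) \<Longrightarrow> norm f \<le> b"
  by transfer (rule norm_blinfun_bound)

lemma bounded_linear_cdual_apply: "bounded_linear (cdual_apply f)"
  by transfer (rule blinfun.bounded_linear_right)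

lemma cdual_apply_scaleC: "cdual_apply f (c *\<^sub>C x) = c * cdual_apply f x"
  by transfer simp

lemma cdual_eqI: "(\<And>x. cdual_apply f x = cdual_apply g x) \<Longrightarrow> f = g"
  by transfer (rule blinfun_eqI)

lemma uniform_boundedness_cdual:
  fixes H :: "'i \<Rightarrow> 'y::complex_banach cdual"
  assumes bdd: "\<And>y. \<exists>B. \<forall>i\<in>S. cmod (cdual_apply (H i) y) \<le> B"
  shows "bounded (H ` S)"
proof -
  define V where "V n = {y. \<forall>i\<in>S. cmod (cdual_apply (H i) y) \<le> real n}" for n
  have cl: "closed (V n)" for n
  proof -
    have "V n = (\<Inter>i\<in>S. {y. cmod (cdual_apply (H i) y) \<le> real n})"
      by (auto simp: V_def)
    moreover have "closed {y. cmod (cdual_apply (H i) y) \<le> real n}" for i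
      by (intro closed_Collect_le continuous_intros linear_continuous_on bounded_linear_cdual_apply)
    ultimately show ?thesis by auto
  qed
  have un: "\<Union> (range V) = UNIV"
  proof -
    have "\<exists>n. y \<in> V n" for y
    proof -
      obtain B where B: "\<forall>i\<in>S. cmod (cdual_apply (H i) y) \<le> B" using bdd by blast
      obtain n where "B \<le> real n" using real_arch_simple by blast
      with B show ?thesis unfolding V_def by (blast intro: order_trans)
    qed
    then show ?thesis by blast
  qed
  have "\<exists>n. interior (V n) \<noteq> {}"
  proof (rule ccontr)
    assume "\<not> ?thesis"
    then have "euclidean interior_of \<Union> (range V) = ({} :: 'y set)"
      using cl Met_TC.metric_Baire_category_alt[where 'a = 'y, of "range V"]
      by (auto simp: mcomplete_iff_complete complete_UNIV)
    with un show False by simp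
  qed
  then obtain n y where "y \<in> interior (V n)" by blast
  then obtain r where r: "r > 0" "cball y r \<subseteq> V n"
    by (auto simp: mem_interior_cball)
  have "cmod (cdual_apply (H i) x) \<le> (2 * real n / r) * norm x" if "i \<in> S" for i x
  proof (cases "x = 0")
    case True
    then show ?thesis using bounded_linear_cdual_apply linear_simps(3) by fastforce
  next
    case False
    define t where "t = r / norm x"
    have t: "t > 0" using r False by (simp add: t_def)
    interpret bounded_linear "cdual_apply (H i)" by (rule bounded_linear_cdual_apply)
    have "y \<in> V n" "y + t *\<^sub>R x \<in> V n"
      using r False by (auto simp: t_def dist_norm subset_iff)
    then have le: "cmod (cdual_apply (H i) y) \<le> real n" "cmod (cdual_apply (H i) (y + t *\<^sub>R x)) \<le> real n"
      using that by (auto simp: V_def)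
    have "t * cmod (cdual_apply (H i) x) = cmod (cdual_apply (H i) (y + t *\<^sub>R x) - cdual_apply (H i) y)"
      using t by (simp add: add scale)
    also have "\<dots> \<le> 2 * real n"
      using le norm_triangle_ineq4[of "cdual_apply (H i) (y + t *\<^sub>R x)" "cdual_apply (H i) y"] by linarith
    finally have "cmod (cdual_apply (H i) x) \<le> 2 * real n / t"
      using t by (simp add: field_simps)
    also have "2 * real n / t = (2 * real n / r) * norm x"
      by (simp add: t_def)
    finally show ?thesis .
  qed
  then have "norm (H i) \<le> 2 * real n / r" if "i \<in> S" for i
    using that r by (intro norm_cdual_bound) auto
  then show ?thesis
    by (auto simp: bounded_iff)
qed

text \<open>The weak-star topology on the dual of \<open>'a\<close>: the topology of pointwise convergence on \<open>'a\<close>.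
  The bidual of \<open>'x\<close> is \<open>'x cdual cdual\<close>, and its weak-star topology is the instance with
  \<open>'a = 'x cdual\<close>.\<close>

definition weak_star :: "'a::complex_normed_vector cdual topology"
  where "weak_star = pullback_topology UNIV cdual_apply (product_topology (\<lambda>_. euclidean) UNIV)"

lemma continuous_map_weak_star:
  "continuous_map M weak_star h \<longleftrightarrow>
    (\<forall>x. continuous_map M euclidean (\<lambda>s. cdual_apply (h s) x))"
proof -
  have "continuous_map M weak_star h \<longleftrightarrow>
      continuous_map M (product_topology (\<lambda>_. euclidean) UNIV) (cdual_apply \<circ> h)"
  proof
    assume h: "continuous_map M weak_star h"
    have "continuous_map weak_star (product_topology (\<lambda>_. euclidean) UNIV) (id \<circ> cdual_apply)"
      unfolding weak_star_def by (rule continuous_map_pullback) simp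
    with h show "continuous_map M (product_topology (\<lambda>_. euclidean) UNIV) (cdual_apply \<circ> h)"
      by (metis continuous_map_compose id_comp)
  next
    assume "continuous_map M (product_topology (\<lambda>_. euclidean) UNIV) (cdual_apply \<circ> h)"
    then show "continuous_map M weak_star h"
      unfolding weak_star_def by (rule continuous_map_pullback') simp
  qed
  then show ?thesis
    by (simp add: continuous_map_componentwise_UNIV o_def)
qed


section \<open>Spaces of functions on a topological space\<close>

text \<open>As in the library's \<^const>\<open>funspace\<close> and \<^const>\<open>cfunspace\<close>, a function on \<open>S\<close> is represented
  by an element of \<^term>\<open>extensional S\<close>, hence the restrictions below. The space
  \<open>C\<^sub>b(\<Omega>,X)\<close> with its supremum metric is \<^term>\<open>cfunspace \<Omega> euclidean_metric\<close>.\<close>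

definition fun_add :: "'s set \<Rightarrow> ('s \<Rightarrow> 'v) \<Rightarrow> ('s \<Rightarrow> 'v) \<Rightarrow> 's \<Rightarrow> 'v::complex_normed_vector"
  where "fun_add S f g = (\<lambda>s\<in>S. f s + g s)"

definition fun_scale :: "'s set \<Rightarrow> complex \<Rightarrow> ('s \<Rightarrow> 'v) \<Rightarrow> 's \<Rightarrow> 'v::complex_normed_vector"
  where "fun_scale S c f = (\<lambda>s\<in>S. c *\<^sub>C f s)"

text \<open>For \<open>'v = complex\<close> this is the product of functions.\<close>

definition fun_mult :: "'s set \<Rightarrow> ('s \<Rightarrow> complex) \<Rightarrow> ('s \<Rightarrow> 'v) \<Rightarrow> 's \<Rightarrow> 'v::complex_normed_vector"
  where "fun_mult S \<phi> f = (\<lambda>s\<in>S. \<phi> s *\<^sub>C f s)"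

text \<open>The case distinction only serves the empty domain, as in \<open>Metric_space.fdist\<close>.\<close>

definition sup_norm :: "'s set \<Rightarrow> ('s \<Rightarrow> 'v::complex_normed_vector) \<Rightarrow> real"
  where "sup_norm S f = (if S = {} then 0 else SUP s\<in>S. norm (f s))"

lemma mdist_funspace_eq_sup_norm:
  fixes f g :: "'s \<Rightarrow> 'v::complex_normed_vector"
  assumes "f \<in> mspace (funspace S euclidean_metric)" "g \<in> mspace (funspace S euclidean_metric)"
  shows "mdist (funspace S euclidean_metric) f g = sup_norm S (\<lambda>s\<in>S. f s - g s)"
  using assms by (simp add: Metric_space.fdist_def[OF Met_TC.Metric_space_axioms] sup_norm_def dist_norm)

definition closed_subspace ::
    "'s set \<Rightarrow> ('s \<Rightarrow> 'v::complex_normed_vector) metric \<Rightarrow> ('s \<Rightarrow> 'v) set \<Rightarrow> bool"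
  where "closed_subspace S m F \<longleftrightarrow>
    closedin (mtopology_of m) F \<and>
    (\<lambda>s\<in>S. 0) \<in> F \<and>
    (\<forall>f\<in>F. \<forall>g\<in>F. fun_add S f g \<in> F) \<and>
    (\<forall>c. \<forall>f\<in>F. fun_scale S c f \<in> F)"

definition isometrically_isomorphic ::
    "'s set \<Rightarrow> ('s \<Rightarrow> 'v::complex_normed_vector) set \<Rightarrow>
     't set \<Rightarrow> ('t \<Rightarrow> 'u::complex_normed_vector) set \<Rightarrow> bool"
  where "isometrically_isomorphic S F S' F' \<longleftrightarrow>
    (\<exists>T. bij_betw T F F' \<and>
      (\<forall>f\<in>F. \<forall>g\<in>F. T (fun_add S f g) = fun_add S' (T f) (T g)) \<and>
      (\<forall>c. \<forall>f\<in>F. T (fun_scale S c f) = fun_scale S' c (T f)) \<and>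
      (\<forall>f\<in>F. sup_norm S' (T f) = sup_norm S f))"


section \<open>Function algebras and vector-valued function spaces\<close>

definition function_algebra :: "'w topology \<Rightarrow> ('w \<Rightarrow> complex) set \<Rightarrow> bool"
  where "function_algebra \<Omega> A \<longleftrightarrow>
    closed_subspace (topspace \<Omega>) (cfunspace \<Omega> euclidean_metric) A \<and>
    (\<forall>f\<in>A. \<forall>g\<in>A. fun_mult (topspace \<Omega>) f g \<in> A) \<and>
    (\<forall>c. (\<lambda>w\<in>topspace \<Omega>. c) \<in> A) \<and>
    (\<forall>w\<in>topspace \<Omega>. \<forall>z\<in>topspace \<Omega>. w \<noteq> z \<longrightarrow> (\<exists>f\<in>A. f w \<noteq> f z))"

definition uniform_algebra :: "'m topology \<Rightarrow> ('m \<Rightarrow> complex) set \<Rightarrow> bool"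
  where "uniform_algebra M A \<longleftrightarrow> compact_space M \<and> Hausdorff_space M \<and> function_algebra M A"

definition base_algebra ::
    "'w topology \<Rightarrow> ('w \<Rightarrow> 'x::complex_normed_vector) set \<Rightarrow> ('w \<Rightarrow> complex) set"
  where "base_algebra \<Omega> F = {restrict (\<lambda>w. cdual_apply x' (f w)) (topspace \<Omega>) | x' f. f \<in> F}"

definition function_space ::
    "'w topology \<Rightarrow> ('w \<Rightarrow> complex) set \<Rightarrow> ('w \<Rightarrow> 'x::complex_normed_vector) set \<Rightarrow> bool"
  where "function_space \<Omega> A F \<longleftrightarrow>
    closed_subspace (topspace \<Omega>) (cfunspace \<Omega> euclidean_metric) F \<and>
    A = base_algebra \<Omega> F \<and>
    function_algebra \<Omega> A \<and>
    (\<forall>\<phi>\<in>A. \<forall>f\<in>F. fun_mult (topspace \<Omega>) \<phi> f \<in> F)"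

text \<open>The space \<open>C(M,(X\<^sup>*\<^sup>*,w\<^sup>*))\<close> with its supremum metric. The library's \<^const>\<open>funspace\<close> consists
  of bounded functions; this is no restriction, because weak-star continuous functions on a compact
  space are bounded, as \<open>mspace_wstar_cfunspace\<close> shows.\<close>

definition wstar_cfunspace ::
    "'m topology \<Rightarrow> ('m \<Rightarrow> 'x::complex_normed_vector cdual cdual) metric"
  where "wstar_cfunspace M =
    submetric (funspace (topspace M) euclidean_metric) {h. continuous_map M weak_star h}"

lemma mspace_wstar_cfunspace:
  fixes M :: "'m topology"
  assumes "compact_space M"
  shows "mspace (wstar_cfunspace M :: ('m \<Rightarrow> 'x::complex_normed_vector cdual cdual) metric) =
    {h \<in> extensional (topspace M). continuous_map M weak_star h}"
proof -
  have "bounded (h ` topspace M)"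
    if "continuous_map M weak_star h" for h :: "'m \<Rightarrow> 'x cdual cdual"
  proof (rule uniform_boundedness_cdual)
    fix y
    have "compactin euclidean ((\<lambda>s. cdual_apply (h s) y) ` topspace M)"
      using that assms by (intro image_compactin[of M])
        (auto simp: continuous_map_weak_star compact_space_def)
    then have "bounded ((\<lambda>s. cdual_apply (h s) y) ` topspace M)"
      by (simp add: compact_imp_bounded)
    then show "\<exists>B. \<forall>s\<in>topspace M. cmod (cdual_apply (h s) y) \<le> B"
      by (auto simp: bounded_iff)
  qed
  then show ?thesis
    by (auto simp: wstar_cfunspace_def Metric_space.fspace_def[OF Met_TC.Metric_space_axioms])
qed

definition wstar_base_algebra ::
    "'m topology \<Rightarrow> ('m \<Rightarrow> 'x::complex_normed_vector cdual cdual) set \<Rightarrow> ('m \<Rightarrow> complex) set"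
  where "wstar_base_algebra M E = {restrict (\<lambda>s. cdual_apply (h s) x') (topspace M) | x' h. h \<in> E}"

definition wstar_function_space ::
    "'m topology \<Rightarrow> ('m \<Rightarrow> complex) set \<Rightarrow> ('m \<Rightarrow> 'x::complex_normed_vector cdual cdual) set \<Rightarrow> bool"
  where "wstar_function_space M B E \<longleftrightarrow>
    compact_space M \<and> Hausdorff_space M \<and>
    closed_subspace (topspace M) (wstar_cfunspace M) E \<and>
    B = wstar_base_algebra M E \<and>
    uniform_algebra M B \<and>
    (\<forall>\<phi>\<in>B. \<forall>h\<in>E. fun_mult (topspace M) \<phi> h \<in> E)"


section \<open>The maximal ideal space and the Gelfand transform\<close>

definition characters :: "'w topology \<Rightarrow> ('w \<Rightarrow> complex) set \<Rightarrow> (('w \<Rightarrow> complex) \<Rightarrow> complex) set"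
  where "characters \<Omega> A =
    {\<phi> \<in> extensional A.
      (\<exists>f\<in>A. \<phi> f \<noteq> 0) \<and>
      (\<forall>f\<in>A. \<forall>g\<in>A. \<phi> (fun_add (topspace \<Omega>) f g) = \<phi> f + \<phi> g) \<and>
      (\<forall>c. \<forall>f\<in>A. \<phi> (fun_scale (topspace \<Omega>) c f) = c * \<phi> f) \<and>
      (\<forall>f\<in>A. \<forall>g\<in>A. \<phi> (fun_mult (topspace \<Omega>) f g) = \<phi> f * \<phi> g)}"

text \<open>The Gelfand topology is the topology of pointwise convergence on \<open>A\<close>.\<close>

definition maximal_ideal_space ::
    "'w topology \<Rightarrow> ('w \<Rightarrow> complex) set \<Rightarrow> (('w \<Rightarrow> complex) \<Rightarrow> complex) topology"
  where "maximal_ideal_space \<Omega> A =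
    subtopology (product_topology (\<lambda>_. euclidean) A) (characters \<Omega> A)"

definition gelfand_transform ::
    "'w topology \<Rightarrow> ('w \<Rightarrow> complex) set \<Rightarrow> ('w \<Rightarrow> complex) \<Rightarrow> (('w \<Rightarrow> complex) \<Rightarrow> complex) \<Rightarrow> complex"
  where "gelfand_transform \<Omega> A f = (\<lambda>\<phi>\<in>characters \<Omega> A. \<phi> f)"

lemma topspace_maximal_ideal_space: "topspace (maximal_ideal_space \<Omega> A) = characters \<Omega> A"
  by (auto simp: maximal_ideal_space_def characters_def PiE_def)

end

theory Submission
  imports Defs
begin

text \<open>The isomorphism is \<open>(T f)(\<phi>)(x\<^sup>*) = \<phi>(x\<^sup>* \<circ> f)\<close>. Characters are contractive, so \<open>\<parallel>T f\<parallel> \<le> \<parallel>f\<parallel>\<close>;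
  at the evaluation character of a point \<open>w\<close>, \<open>T f\<close> is the canonical image of \<open>f w\<close> in the bidual, so
  \<open>\<parallel>T f\<parallel> \<ge> \<parallel>f\<parallel>\<close> by the Hahn--Banach theorem. The functions \<open>x\<^sup>* \<circ> T f\<close> are exactly the Gelfand
  transforms of the \<open>x\<^sup>* \<circ> f\<close>, and multiplicativity of characters gives the module property. Both the range of \<open>T\<close>
  and that of the Gelfand transform are closed, as isometric images of complete spaces.\<close>

section \<open>Sublinear functionals and the Hahn--Banach theorem\<close>

text \<open>Homogeneity is asked for only as an inequality at \<open>r > 0\<close>, which passes
  easily to infima; equality and \<open>p 0 = 0\<close> follow by also using the inverse
  factor.\<close>

definition sublinear :: "('a::real_vector \<Rightarrow> real) \<Rightarrow> bool"
  where "sublinear p \<longleftrightarrow>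
    (\<forall>x y. p (x + y) \<le> p x + p y) \<and> (\<forall>r>0. \<forall>x. p (r *\<^sub>R x) \<le> r * p x)"

lemma sublinear_add: "sublinear p \<Longrightarrow> p (x + y) \<le> p x + p y"
  by (simp add: sublinear_def)

lemma sublinear_0:
  assumes "sublinear p"
  shows "p 0 = 0"
proof -
  have "p (2 *\<^sub>R 0) \<le> 2 * p 0" "p ((1/2) *\<^sub>R 0) \<le> (1/2) * p 0"
    using assms unfolding sublinear_def by (blast intro: zero_less_numeral half_gt_zero zero_less_one)+
  then show ?thesis by simp
qed

lemma sublinear_scaleR:
  assumes "sublinear p" "0 \<le> r"
  shows "p (r *\<^sub>R x) = r * p x"
proof (cases "r = 0")
  case True
  then show ?thesis using assms by (simp add: sublinear_0)
next
  case False
  with assms have r: "r > 0" by simp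
  have "p (inverse r *\<^sub>R (r *\<^sub>R x)) \<le> inverse r * p (r *\<^sub>R x)"
    using assms r unfolding sublinear_def by (meson positive_imp_inverse_positive)
  then have "r * p x \<le> p (r *\<^sub>R x)"
    using r by (simp add: field_simps)
  moreover have "p (r *\<^sub>R x) \<le> r * p x"
    using assms r unfolding sublinear_def by blast
  ultimately show ?thesis by simp
qed

lemma sublinear_minus:
  assumes "sublinear p"
  shows "- p (- x) \<le> p x"
  using sublinear_add[OF assms, of x "- x"] sublinear_0[OF assms] by simp

text \<open>Serves both for the directional witness and for lower bounds of chains. The bound
  \<open>b\<close> keeps the infima finite; an index \<open>k\<close>, chosen after the points,
  absorbs the sum of two members, so the members need not be sublinear themselves.\<close>

lemma sublinear_INF:
  assumes ne: "I \<noteq> {}"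
    and low: "\<And>i y. i \<in> I \<Longrightarrow> b y \<le> g i y"
    and add: "\<And>i j y z. i \<in> I \<Longrightarrow> j \<in> I \<Longrightarrow> \<exists>k\<in>I. g k (y + z) \<le> g i y + g j z"
    and scale: "\<And>i r y. i \<in> I \<Longrightarrow> r > 0 \<Longrightarrow> \<exists>k\<in>I. g k (r *\<^sub>R y) \<le> r * g i y"
  shows "sublinear (\<lambda>y. INF i\<in>I. g i y :: real)"
proof -
  have bdd: "bdd_below ((\<lambda>i. g i y) ` I)" for y
    using low by (intro bdd_belowI2[of _ "b y"])
  have le: "(INF i\<in>I. g i y) \<le> a" if "\<exists>k\<in>I. g k y \<le> a" for y a
    using that bdd by (meson cINF_lower order_trans)
  show ?thesis
    unfolding sublinear_def
  proof (intro conjI allI impI)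
    fix y z
    have "(INF i\<in>I. g i (y + z)) - g i y \<le> (INF j\<in>I. g j z)" if "i \<in> I" for i
      using le add[OF that] by (intro cINF_greatest[OF ne]) (simp add: algebra_simps)
    then have "(INF i\<in>I. g i (y + z)) - (INF j\<in>I. g j z) \<le> (INF i\<in>I. g i y)"
      by (intro cINF_greatest[OF ne]) (simp add: algebra_simps)
    then show "(INF i\<in>I. g i (y + z)) \<le> (INF i\<in>I. g i y) + (INF i\<in>I. g i z)"
      by simp
  next
    fix r :: real and y
    assume r: "r > 0"
    have "(INF i\<in>I. g i (r *\<^sub>R y)) / r \<le> (INF i\<in>I. g i y)"
      using le[OF scale[OF _ r]] r by (intro cINF_greatest[OF ne]) (simp add: field_simps)
    then show "(INF i\<in>I. g i (r *\<^sub>R y)) \<le> r * (INF i\<in>I. g i y)"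
      using r by (simp add: field_simps)
  qed
qed

text \<open>The witness is \<open>q y = inf\<^sub>t\<^sub>\<ge>\<^sub>0 (p (y + t x) - t p x)\<close>. It shows that a minimal sublinear functional is
  odd, hence linear, so that Zorn's lemma for sublinear functionals yields the Hahn--Banach theorem
  without extending functionals from subspaces.\<close>

lemma sublinear_lower_direction:
  assumes p: "sublinear p"
  obtains q where "sublinear q" "q \<le> p" "q (- x) \<le> - p x"
proof
  define g where "g t y = p (y + t *\<^sub>R x) - t * p x" for t y
  define q where "q y = (INF t\<in>{0..}. g t y)" for y
  \<comment> \<open>From \<open>t *\<^sub>R x = (y + t *\<^sub>R x) + (- y)\<close> and
    \<open>p (t *\<^sub>R x) = t * p x\<close>.\<close>
  have low: "- p (- y) \<le> g t y" if "t \<in> {0..}" for t y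
    using sublinear_add[OF p, of "y + t *\<^sub>R x" "- y"] sublinear_scaleR[OF p, of t x] that
    by (simp add: g_def)
  have q_le: "q y \<le> g t y" if "t \<ge> 0" for t y
    unfolding q_def using that low by (intro cINF_lower bdd_belowI2[of _ "- p (- y)"]) auto
  show "sublinear q"
    unfolding q_def
  proof (rule sublinear_INF[where b = "\<lambda>y. - p (- y)"])
    fix s t y z
    assume "s \<in> {0::real..}" "t \<in> {0::real..}"
    moreover have "g (s + t) (y + z) \<le> g s y + g t z"
      using sublinear_add[OF p, of "y + s *\<^sub>R x" "z + t *\<^sub>R x"]
      by (simp add: g_def algebra_simps)
    ultimately show "\<exists>k\<in>{0..}. g k (y + z) \<le> g s y + g t z"
      by (intro bexI[of _ "s + t"]) auto
  next
    fix t r :: real and y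
    assume "t \<in> {0..}" "r > 0"
    moreover have "g (r * t) (r *\<^sub>R y) = r * g t y"
      using sublinear_scaleR[OF p, of r "y + t *\<^sub>R x"] \<open>r > 0\<close>
      by (simp add: g_def algebra_simps)
    ultimately show "\<exists>k\<in>{0..}. g k (r *\<^sub>R y) \<le> r * g t y"
      by (intro bexI[of _ "r * t"]) auto
  qed (use low in auto)
  show "q \<le> p"
    using q_le[of 0] by (simp add: g_def le_fun_def)
  show "q (- x) \<le> - p x"
    using q_le[of 1 "- x"] sublinear_0[OF p] by (simp add: g_def)
qed

lemma sublinear_minimal_imp_linear:
  assumes q: "sublinear q" and min: "\<And>q'. sublinear q' \<Longrightarrow> q' \<le> q \<Longrightarrow> q' = q"
  shows "linear q"
proof -
  have neg: "q (- x) = - q x" for x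
  proof -
    obtain q' where "sublinear q'" "q' \<le> q" "q' (- x) \<le> - q x"
      using sublinear_lower_direction[OF q] by blast
    then have "q (- x) \<le> - q x" using min by blast
    with sublinear_minus[OF q, of x] show ?thesis by simp
  qed
  show ?thesis
  proof (rule linearI)
    fix x y
    \<comment> \<open>The reverse inequality is subadditivity at \<open>- x\<close> and
      \<open>- y\<close>, turned round by oddness.\<close>
    show "q (x + y) = q x + q y"
      using sublinear_add[OF q, of x y] sublinear_add[OF q, of "- x" "- y"] neg[of "x + y"]
      by (simp add: neg)
  next
    fix r x
    show "q (r *\<^sub>R x) = r *\<^sub>R q x"
      using sublinear_scaleR[OF q, of r x] sublinear_scaleR[OF q, of "- r" x] neg[of "r *\<^sub>R x"]
      by (cases "r \<ge> 0") auto
  qed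
qed

text \<open>Zorn's lemma for the reversed pointwise order: a chain has its pointwise infimum as
  lower bound, and this is finite because a sublinear functional below \<open>p\<close> is at least
  \<open>- p (- y)\<close> at \<open>y\<close>.\<close>

lemma ex_minimal_sublinear:
  assumes p: "sublinear p"
  obtains q where "sublinear q" "q \<le> p" "\<And>q'. sublinear q' \<Longrightarrow> q' \<le> q \<Longrightarrow> q' = q"
proof -
  define Q where "Q = {q. sublinear q \<and> q \<le> p}"
  have "\<exists>m\<in>Q. \<forall>a\<in>Q. m \<ge> a \<longrightarrow> a = m"
  proof (rule predicate_Zorn)
    show "partial_order_on Q (relation_of (\<ge>) Q)"
      by (intro partial_order_on_relation_ofI) auto
  next
    fix C
    assume C: "C \<in> Chains (relation_of (\<ge>) Q)"
    then have CQ: "C \<subseteq> Q" and chain: "\<And>a b. a \<in> C \<Longrightarrow> b \<in> C \<Longrightarrow> a \<le> b \<or> b \<le> a"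
      by (auto simp: Chains_def relation_of_def)
    show "\<exists>u\<in>Q. \<forall>a\<in>C. u \<le> a"
    proof (cases "C = {}")
      case True
      then show ?thesis using p by (auto simp: Q_def)
    next
      case False
      define u where "u y = (INF a\<in>C. a y)" for y
      have low: "- p (- y) \<le> a y" if "a \<in> C" for a y
      proof -
        have "sublinear a" "a \<le> p" using that CQ by (auto simp: Q_def)
        then show ?thesis
          using sublinear_minus[of a y] by (simp add: le_fun_def) (meson neg_le_iff_le order_trans)
      qed
      have le: "u \<le> a" if "a \<in> C" for a
        unfolding u_def le_fun_def using that low
        by (intro allI cINF_lower bdd_belowI2[of _ "- p (- y)" for y]) auto
      have "sublinear u"
        unfolding u_def
      proof (rule sublinear_INF[OF False])
        fix a b y z
        assume ab: "a \<in> C" "b \<in> C"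
        then have "sublinear a" "sublinear b" using CQ by (auto simp: Q_def)
        then have "a (y + z) \<le> a y + a z" "b (y + z) \<le> b y + b z"
          by (simp_all add: sublinear_add)
        \<comment> \<open>Members of a chain compare alike at both points, so the smaller of
          \<open>a\<close> and \<open>b\<close> serves as \<open>k\<close>.\<close>
        moreover have "(a y \<le> b y \<and> a z \<le> b z) \<or> (b y \<le> a y \<and> b z \<le> a z)"
          using chain[OF ab] by (auto simp: le_fun_def)
        ultimately have "a (y + z) \<le> a y + b z \<or> b (y + z) \<le> a y + b z" by linarith
        then show "\<exists>k\<in>C. k (y + z) \<le> a y + b z" using ab by blast
      next
        fix a y and r :: real
        assume "a \<in> C" "r > 0"
        then show "\<exists>k\<in>C. k (r *\<^sub>R y) \<le> r * a y"
          using CQ by (intro bexI[of _ a]) (auto simp: Q_def sublinear_def)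
      qed (use low in auto)
      moreover have "u \<le> p"
      proof -
        obtain a where "a \<in> C" using False by blast
        then show ?thesis using le[of a] CQ order_trans[of u a p] by (auto simp: Q_def)
      qed
      ultimately show ?thesis using le by (auto simp: Q_def)
    qed
  qed
  then obtain q where q: "q \<in> Q" "\<And>a. a \<in> Q \<Longrightarrow> a \<le> q \<Longrightarrow> a = q" by blast
  show ?thesis
  proof
    show "sublinear q" "q \<le> p" using q by (auto simp: Q_def)
    show "q' = q" if "sublinear q'" "q' \<le> q" for q'
      using q(2)[of q'] that order_trans[OF that(2) \<open>q \<le> p\<close>] by (simp add: Q_def)
  qed
qed

text \<open>First \<open>p\<close> is lowered to \<open>p'\<close> with
  \<open>p' (- x) \<le> - p x\<close>. A minimal sublinear \<open>u\<close> below \<open>p'\<close>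
  is linear, so \<open>u (- x) \<le> - p x\<close> says that \<open>p x \<le> u x\<close>.\<close>

theorem Hahn_Banach_sublinear:
  fixes p :: "'a::real_vector \<Rightarrow> real"
  assumes p: "sublinear p"
  obtains u where "linear u" "u \<le> p" "u x = p x"
proof -
  obtain p' where p': "sublinear p'" "p' \<le> p" "p' (- x) \<le> - p x"
    using sublinear_lower_direction[OF p] .
  obtain u where u: "sublinear u" "u \<le> p'" "\<And>q'. sublinear q' \<Longrightarrow> q' \<le> u \<Longrightarrow> q' = u"
    using ex_minimal_sublinear[OF p'(1)] by blast
  have lin: "linear u"
    using sublinear_minimal_imp_linear u by blast
  have le: "u \<le> p" using u(2) p'(2) by (rule order_trans)
  have "u (- x) \<le> - p x"
    using le_funD[OF u(2), of "- x"] p'(3) by (rule order_trans)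
  then have "p x \<le> u x"
    by (simp add: linear_neg[OF lin])
  with le have "u x = p x" by (simp add: le_fun_def antisym)
  with lin le show ?thesis by (rule that)
qed

section \<open>Bounded complex-linear functionals and norming functionals\<close>

definition cdual_of :: "('a::complex_normed_vector \<Rightarrow> complex) \<Rightarrow> 'a cdual"
  where "cdual_of f = Abs_cdual (Blinfun f)"

text \<open>\<open>cdual_of\<close> is meaningful only for bounded complex-linear \<open>f\<close>,
  where \<open>Blinfun\<close> and \<open>Abs_cdual\<close> invert the representations; real
  homogeneity is \<open>scale\<close> at a real scalar.\<close>

lemma cdual_apply_cdual_of:
  assumes add: "\<And>x y. f (x + y) = f x + f y"
    and scale: "\<And>c x. f (c *\<^sub>C x) = c * f x"
    and bound: "\<And>x. cmod (f x) \<le> B * norm x"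
  shows "cdual_apply (cdual_of f) = f"
proof -
  have "bounded_linear f"
  proof (rule bounded_linear_intro)
    show "f (r *\<^sub>R x) = r *\<^sub>R f x" for r x
      using scale[of "complex_of_real r" x] by (simp add: scaleC_of_real scaleR_conv_of_real)
    show "norm (f x) \<le> norm x * B" for x
      using bound[of x] by (simp add: mult.commute)
  qed (rule add)
  then have "blinfun_apply (Blinfun f) = f"
    by (rule bounded_linear_Blinfun_apply)
  with scale show ?thesis
    by (simp add: cdual_of_def cdual_apply.rep_eq Abs_cdual_inverse)
qed

text \<open>Hahn-Banach for \<open>p = norm\<close> gives a real-linear \<open>u\<close> attaining
  \<open>norm x\<close>; it is the real part of a complex-linear \<open>f\<close>, which is bounded
  by rotating each of its values onto the positive axis.\<close>

lemma ex_norming_cdual: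
  fixes x :: "'a::complex_normed_vector"
  obtains f where "norm f \<le> 1" "cmod (cdual_apply f x) = norm x"
proof -
  have "sublinear (norm :: 'a \<Rightarrow> real)"
    by (simp add: sublinear_def norm_triangle_ineq)
  then obtain u where u: "linear u" "u \<le> norm" "u x = norm x"
    using Hahn_Banach_sublinear by blast
  \<comment> \<open>That is, \<open>u y - \<i> * u (\<i> *\<^sub>C y)\<close>, the form that complex
    linearity forces on a functional with real part \<open>u\<close>.\<close>
  define f where "f y = Complex (u y) (- u (\<i> *\<^sub>C y))" for y
  have Re_f: "Re (f y) = u y" for y by (simp add: f_def)
  have ii: "\<i> *\<^sub>C \<i> *\<^sub>C y = - y" for y :: 'a
    using scaleC_of_real[of "- 1" y] by (simp add: scaleC_scaleC)
  have add: "f (y + z) = f y + f z" for y z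
    by (simp add: f_def scaleC_add_right linear_add[OF u(1)] complex_eq_iff)
  have sc: "u (c *\<^sub>C y) = Re c * u y + Im c * u (\<i> *\<^sub>C y)" for c y
  proof -
    have "c *\<^sub>C y = (complex_of_real (Re c) + complex_of_real (Im c) * \<i>) *\<^sub>C y"
      by (simp add: mult.commute flip: complex_eq)
    also have "\<dots> = Re c *\<^sub>R y + Im c *\<^sub>R (\<i> *\<^sub>C y)"
      by (simp only: scaleC_add_left scaleC_of_real flip: scaleC_scaleC)
    finally have "c *\<^sub>C y = Re c *\<^sub>R y + Im c *\<^sub>R (\<i> *\<^sub>C y)" .
    then show ?thesis by (simp add: linear_add[OF u(1)] linear_scale[OF u(1)])
  qed
  have scale: "f (c *\<^sub>C y) = c * f y" for c y
    using sc[of c y] sc[of "\<i> * c" y] by (simp add: f_def scaleC_scaleC complex_eq_iff)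
  have bound: "cmod (f y) \<le> norm y" for y
  proof (cases "f y = 0")
    case False
    \<comment> \<open>A unimodular factor with \<open>c * f y = cmod (f y)\<close>, so that
      \<open>cmod (f y)\<close> is the real part of \<open>f (c *\<^sub>C y)\<close>, namely
      \<open>u (c *\<^sub>C y)\<close>.\<close>
    define c where "c = cnj (f y) / cmod (f y)"
    have "cnj (f y) * f y = cmod (f y) * cmod (f y)"
      by (metis complex_norm_square mult.commute of_real_mult power2_eq_square)
    then have c: "cmod c = 1" "c * f y = cmod (f y)"
      using False by (simp_all add: c_def norm_divide)
    have "cmod (f y) = u (c *\<^sub>C y)"
      using scale[of c y] Re_f[of "c *\<^sub>C y"] c by simp
    also have "\<dots> \<le> norm (c *\<^sub>C y)" using u(2) by (simp add: le_fun_def)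
    finally show ?thesis by (simp add: norm_scaleC c)
  qed simp
  have app: "cdual_apply (cdual_of f) = f"
    using bound by (intro cdual_apply_cdual_of[where B = 1] add scale) simp
  show ?thesis
  proof
    show "norm (cdual_of f) \<le> 1"
      using bound by (intro norm_cdual_bound) (auto simp: app)
    show "cmod (cdual_apply (cdual_of f) x) = norm x"
      using bound[of x] complex_Re_le_cmod[of "f x"] by (simp add: app Re_f u(3))
  qed
qed

lemma cdual_apply_add: "cdual_apply f (x + y) = cdual_apply f x + cdual_apply f y"
  by (simp add: linear_simps(1)[OF bounded_linear_cdual_apply])

lemma cdual_apply_add_left: "cdual_apply (f + g) x = cdual_apply f x + cdual_apply g x"
  by transfer (rule blinfun.add_left)

lemma cdual_apply_scaleC_left: "cdual_apply (c *\<^sub>C f) x = c * cdual_apply f x"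
  by transfer simp

section \<open>Spaces of bounded functions\<close>

lemma scaleC_0_left [simp]: "0 *\<^sub>C x = 0"
  using scaleC_of_real[of 0 x] by simp

lemma scaleC_minus_1_left [simp]: "(- 1) *\<^sub>C x = - x"
  using scaleC_of_real[of "- 1" x] by simp

lemma mspace_funspace_euclidean:
  "mspace (funspace S (euclidean_metric :: 'v::real_normed_vector metric)) =
    {f \<in> extensional S. bounded (f ` S)}"
  by (auto simp: Metric_space.fspace_def[OF Met_TC.Metric_space_axioms] Met_TC.mbounded_def
      bounded_def image_subset_iff)

lemma mem_cfunspace_iff:
  fixes f :: "'s \<Rightarrow> 'v::real_normed_vector"
  shows "f \<in> mspace (cfunspace X euclidean_metric) \<longleftrightarrow>
    f \<in> extensional (topspace X) \<and> bounded (f ` topspace X) \<and> continuous_map X euclidean f"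
  using mspace_funspace_euclidean[of "topspace X", where 'v = 'v] by (auto simp: cfunspace_def)

lemma mem_wstar_cfunspace_iff:
  fixes h :: "'m \<Rightarrow> 'x::complex_normed_vector cdual cdual"
  shows "h \<in> mspace (wstar_cfunspace M) \<longleftrightarrow>
    h \<in> extensional (topspace M) \<and> bounded (h ` topspace M) \<and> continuous_map M weak_star h"
  using mspace_funspace_euclidean[of "topspace M", where 'v = "'x cdual cdual"]
  by (auto simp: wstar_cfunspace_def)

lemma mcomplete_cfunspace_euclidean:
  "mcomplete_of (cfunspace X (euclidean_metric :: 'v::banach metric))"
  using Met_TC.mcomplete_cfunspace[where 'a = 'v, of X]
  by (simp add: complete_UNIV Met_TC.Self_def euclidean_metric_def)

lemma norm_le_sup_norm:
  assumes "bounded (f ` S)" "s \<in> S"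
  shows "norm (f s) \<le> sup_norm S f"
proof -
  have "bdd_above ((\<lambda>s. norm (f s)) ` S)"
    using assms(1) by (auto simp: bounded_iff bdd_above_def)
  then show ?thesis
    using assms(2) by (auto simp: sup_norm_def intro: cSUP_upper)
qed

lemma sup_norm_le:
  assumes "0 \<le> b" "\<And>s. s \<in> S \<Longrightarrow> norm (f s) \<le> b"
  shows "sup_norm S f \<le> b"
  using assms by (auto simp: sup_norm_def intro: cSUP_least)

lemma sup_norm_nonneg:
  assumes "bounded (f ` S)"
  shows "0 \<le> sup_norm S f"
proof (cases "S = {}")
  case False
  then obtain s where "s \<in> S" by blast
  then show ?thesis
    using norm_le_sup_norm[OF assms] norm_ge_zero order_trans by metis
qed (simp add: sup_norm_def)

section \<open>Isometric linear images of closed subspaces\<close>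

lemma closed_subspace_diff:
  assumes "closed_subspace S m F" "f \<in> F" "g \<in> F"
  shows "fun_add S f (fun_scale S (- 1) g) \<in> F"
  using assms by (simp add: closed_subspace_def)

text \<open>Brings differences into the form of \<open>fun_add\<close> and \<open>fun_scale\<close>,
  the operations that the maps \<open>T\<close> respect.\<close>

lemma fun_diff_eq: "(\<lambda>s\<in>S. f s - g s) = fun_add S f (fun_scale S (- 1) g)"
  by (auto simp: fun_add_def fun_scale_def)

text \<open>By linearity, the distance of two images is the norm of the image of a difference.
  \<open>m\<close> and \<open>m'\<close> stand for metrics inherited from \<open>funspace\<close>,
  which covers \<open>cfunspace\<close> and \<open>wstar_cfunspace\<close> alike.\<close>

lemma mdist_isometry:
  assumes F: "closed_subspace S m F"
    and m: "mspace m \<subseteq> mspace (funspace S euclidean_metric)" "mdist m = mdist (funspace S euclidean_metric)"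
    and m': "mspace m' \<subseteq> mspace (funspace S' euclidean_metric)" "mdist m' = mdist (funspace S' euclidean_metric)"
    and im: "\<And>f. f \<in> F \<Longrightarrow> T f \<in> mspace m'"
    and add: "\<And>f g. f \<in> F \<Longrightarrow> g \<in> F \<Longrightarrow> T (fun_add S f g) = fun_add S' (T f) (T g)"
    and scale: "\<And>c f. f \<in> F \<Longrightarrow> T (fun_scale S c f) = fun_scale S' c (T f)"
    and iso: "\<And>f. f \<in> F \<Longrightarrow> sup_norm S' (T f) = sup_norm S f"
    and fg: "f \<in> F" "g \<in> F"
  shows "mdist m' (T f) (T g) = mdist m f g"
proof -
  have Fm: "F \<subseteq> mspace m"
    using F closedin_subset[of "mtopology_of m" F] by (simp add: closed_subspace_def)
  have mem: "fun_scale S (- 1) g \<in> F"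
    using F fg by (simp add: closed_subspace_def)
  have "mdist m' (T f) (T g) = sup_norm S' (fun_add S' (T f) (fun_scale S' (- 1) (T g)))"
    using m' im[OF fg(1)] im[OF fg(2)] by (simp add: mdist_funspace_eq_sup_norm subset_iff fun_diff_eq del: mdist_funspace)
  also have "\<dots> = sup_norm S' (T (fun_add S f (fun_scale S (- 1) g)))"
    using fg mem by (simp add: add scale)
  also have "\<dots> = sup_norm S (fun_add S f (fun_scale S (- 1) g))"
    using closed_subspace_diff[OF F fg] by (rule iso)
  also have "\<dots> = mdist m f g"
    using m Fm fg by (simp add: mdist_funspace_eq_sup_norm subset_iff fun_diff_eq del: mdist_funspace)
  finally show ?thesis .
qed

text \<open>\<open>F\<close> is complete as a closed subset of a complete space. A Cauchy sequence
  in the image pulls back to one in \<open>F\<close>, so the image is complete, and a complete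
  subset is closed.\<close>

lemma closedin_isometric_image:
  assumes F: "closedin (mtopology_of m) F" and m: "mcomplete_of m"
    and im: "T ` F \<subseteq> mspace m'"
    and iso: "\<And>f g. f \<in> F \<Longrightarrow> g \<in> F \<Longrightarrow> mdist m' (T f) (T g) = mdist m f g"
  shows "closedin (mtopology_of m') (T ` F)"
proof -
  interpret S: Submetric "mspace m" "mdist m" F
    using closedin_subset[OF F] by (simp add: Submetric_def Submetric_axioms_def)
  interpret S': Submetric "mspace m'" "mdist m'" "T ` F"
    using im by (simp add: Submetric_def Submetric_axioms_def)
  have compl: "S.sub.mcomplete"
    using F m by (intro S.closedin_mcomplete_imp_mcomplete) (auto simp: mtopology_of_def mcomplete_of_def)
  have "S'.sub.mcomplete"
    unfolding S'.sub.mcomplete_def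
  proof (intro allI impI)
    fix \<sigma> assume \<sigma>: "S'.sub.MCauchy \<sigma>"
    then have "\<sigma> n \<in> T ` F" for n by (auto simp: S'.sub.MCauchy_def)
    then have "\<forall>n. \<exists>f. f \<in> F \<and> \<sigma> n = T f" by blast
    then obtain \<rho> where \<rho>: "\<And>n. \<rho> n \<in> F" "\<And>n. \<sigma> n = T (\<rho> n)" by metis
    have "S.sub.MCauchy \<rho>"
      using \<sigma> \<rho> by (auto simp: S'.sub.MCauchy_def S.sub.MCauchy_def iso)
    then obtain f where "limitin S.sub.mtopology \<rho> f sequentially"
      using compl S.sub.mcomplete_def by blast
    then have "limitin S'.sub.mtopology \<sigma> (T f) sequentially"
      using \<rho> by (auto simp: S.sub.limit_metric_sequentially S'.sub.limit_metric_sequentially iso)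
    then show "\<exists>x. limitin S'.sub.mtopology \<sigma> x sequentially" by blast
  qed
  then show ?thesis
    using S'.mcomplete_imp_closedin by (simp add: mtopology_of_def)
qed

text \<open>Applied twice: to the scalar transform on \<open>A\<close>, and to the vector-valued
  transform with its weak-star target.\<close>

lemma closed_subspace_isometric_image:
  assumes F: "closed_subspace S m F" and compl: "mcomplete_of m"
    and m: "mspace m \<subseteq> mspace (funspace S euclidean_metric)" "mdist m = mdist (funspace S euclidean_metric)"
    and m': "mspace m' \<subseteq> mspace (funspace S' euclidean_metric)" "mdist m' = mdist (funspace S' euclidean_metric)"
    and im: "\<And>f. f \<in> F \<Longrightarrow> T f \<in> mspace m'"
    and add: "\<And>f g. f \<in> F \<Longrightarrow> g \<in> F \<Longrightarrow> T (fun_add S f g) = fun_add S' (T f) (T g)"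
    and scale: "\<And>c f. f \<in> F \<Longrightarrow> T (fun_scale S c f) = fun_scale S' c (T f)"
    and iso: "\<And>f. f \<in> F \<Longrightarrow> sup_norm S' (T f) = sup_norm S f"
  shows "closed_subspace S' m' (T ` F)" and "inj_on T F"
proof -
  have dist: "mdist m' (T f) (T g) = mdist m f g" if "f \<in> F" "g \<in> F" for f g
    using mdist_isometry[OF F m m' im add scale iso that] .
  have Fm: "F \<subseteq> mspace m"
    using F closedin_subset[of "mtopology_of m" F] by (simp add: closed_subspace_def)
  have "closedin (mtopology_of m') (T ` F)"
    using F im by (intro closedin_isometric_image[OF _ compl]) (auto simp: closed_subspace_def dist)
  moreover have "(\<lambda>s\<in>S'. 0) \<in> T ` F"
  proof
    show z: "(\<lambda>s\<in>S. 0) \<in> F" using F by (simp add: closed_subspace_def)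
    \<comment> \<open>\<open>T\<close> maps zero to zero because zero is the scalar \<open>0\<close>
      times itself.\<close>
    have "fun_scale S 0 (\<lambda>s\<in>S. 0 :: 'b) = (\<lambda>s\<in>S. 0)"
      by (auto simp: fun_scale_def)
    then have "T (\<lambda>s\<in>S. 0) = fun_scale S' 0 (T (\<lambda>s\<in>S. 0))"
      using scale[OF z, of 0] by simp
    then show "(\<lambda>s\<in>S'. 0) = T (\<lambda>s\<in>S. 0)"
      by (simp add: fun_scale_def)
  qed
  ultimately show "closed_subspace S' m' (T ` F)"
    using F by (auto simp: closed_subspace_def simp flip: add scale)
  show "inj_on T F"
  proof (rule inj_onI)
    fix f g assume fg: "f \<in> F" "g \<in> F" "T f = T g"
    then have "mdist m f g = 0"
      using dist[OF fg(1,2)] Metric_space.zero[OF Metric_space_mspace_mdist im[OF fg(1)] im[OF fg(2)]]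
      by simp
    then show "f = g"
      using fg Fm by (simp add: subset_iff Metric_space.zero[OF Metric_space_mspace_mdist])
  qed
qed

lemmas closed_subspace_isometric_image_cfunspace =
  closed_subspace_isometric_image[OF _ mcomplete_cfunspace_euclidean
    cfunspace_subset_funspace mdist_cfunspace_eq_mdist_funspace]


section \<open>Characters of a function algebra\<close>

lemma function_algebraD:
  assumes "function_algebra \<Omega> A"
  shows "closed_subspace (topspace \<Omega>) (cfunspace \<Omega> euclidean_metric) A"
    and "f \<in> A \<Longrightarrow> f \<in> extensional (topspace \<Omega>)"
    and "f \<in> A \<Longrightarrow> bounded (f ` topspace \<Omega>)"
    and "f \<in> A \<Longrightarrow> g \<in> A \<Longrightarrow> fun_add (topspace \<Omega>) f g \<in> A"
    and "f \<in> A \<Longrightarrow> fun_scale (topspace \<Omega>) c f \<in> A"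
    and "f \<in> A \<Longrightarrow> g \<in> A \<Longrightarrow> fun_mult (topspace \<Omega>) f g \<in> A"
    and "(\<lambda>w\<in>topspace \<Omega>. c) \<in> A"
proof -
  show cs: "closed_subspace (topspace \<Omega>) (cfunspace \<Omega> euclidean_metric) A"
    using assms by (simp add: function_algebra_def)
  then have sub: "A \<subseteq> mspace (cfunspace \<Omega> euclidean_metric)"
    using closedin_subset by (fastforce simp: closed_subspace_def simp del: mspace_cfunspace)
  then show "f \<in> A \<Longrightarrow> f \<in> extensional (topspace \<Omega>)" "f \<in> A \<Longrightarrow> bounded (f ` topspace \<Omega>)"
    by (auto simp: mem_cfunspace_iff simp del: mspace_cfunspace)
qed (use assms in \<open>auto simp: function_algebra_def closed_subspace_def\<close>)

lemma charactersD:
  assumes "\<phi> \<in> characters \<Omega> A"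
  shows "f \<in> A \<Longrightarrow> g \<in> A \<Longrightarrow> \<phi> (fun_add (topspace \<Omega>) f g) = \<phi> f + \<phi> g"
    and "f \<in> A \<Longrightarrow> \<phi> (fun_scale (topspace \<Omega>) c f) = c * \<phi> f"
    and "f \<in> A \<Longrightarrow> g \<in> A \<Longrightarrow> \<phi> (fun_mult (topspace \<Omega>) f g) = \<phi> f * \<phi> g"
  using assms by (auto simp: characters_def)

text \<open>Cancel a nonzero value in \<open>\<phi> f = \<phi> f * \<phi> 1\<close>; homogeneity
  does the rest.\<close>

lemma character_const:
  assumes A: "function_algebra \<Omega> A" and \<phi>: "\<phi> \<in> characters \<Omega> A"
  shows "\<phi> (\<lambda>w\<in>topspace \<Omega>. c) = c"
proof -
  let ?one = "\<lambda>w\<in>topspace \<Omega>. 1 :: complex"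
  have one: "?one \<in> A" using A by (rule function_algebraD)
  obtain f where f: "f \<in> A" "\<phi> f \<noteq> 0" using \<phi> by (auto simp: characters_def)
  have "fun_mult (topspace \<Omega>) f ?one = f"
    using function_algebraD(2)[OF A f(1)]
    by (intro ext) (auto simp: fun_mult_def scaleC_complex_def extensional_def)
  then have "\<phi> ?one = 1"
    using charactersD(3)[OF \<phi> f(1) one] f(2) by simp
  moreover have "(\<lambda>w\<in>topspace \<Omega>. c) = fun_scale (topspace \<Omega>) c ?one"
    by (auto simp: fun_scale_def scaleC_complex_def)
  ultimately show ?thesis using charactersD(2)[OF \<phi> one] by simp
qed

text \<open>If \<open>\<phi> h = 1\<close> while \<open>\<parallel>h\<parallel> < 1\<close>, then the contraction \<open>g \<mapsto> 1 + h g\<close> of \<open>A\<close> has a fixed point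
  \<open>g\<close>, and \<open>\<phi> g = 1 + \<phi> g\<close>.\<close>

lemma character_le_sup_norm:
  assumes A: "function_algebra \<Omega> A" and \<phi>: "\<phi> \<in> characters \<Omega> A" and f: "f \<in> A"
  shows "cmod (\<phi> f) \<le> sup_norm (topspace \<Omega>) f"
proof (rule ccontr)
  let ?S = "topspace \<Omega>"
  let ?m = "cfunspace \<Omega> (euclidean_metric :: complex metric)"
  assume "\<not> ?thesis"
  then have gt: "sup_norm ?S f < cmod (\<phi> f)" by simp
  have pos: "0 \<le> sup_norm ?S f"
    using function_algebraD(3)[OF A f] by (rule sup_norm_nonneg)
  with gt have nz: "\<phi> f \<noteq> 0" by auto
  define h where "h = fun_scale ?S (inverse (\<phi> f)) f"
  define k where "k = sup_norm ?S f / cmod (\<phi> f)"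
  define G where "G g = fun_add ?S (\<lambda>w\<in>?S. 1) (fun_mult ?S h g)" for g :: "'a \<Rightarrow> complex"
  have k: "0 \<le> k" "k < 1" using pos gt nz by (auto simp: k_def)
  have h: "h \<in> A" "\<phi> h = 1"
    using f nz by (auto simp: h_def charactersD(2)[OF \<phi>] function_algebraD(5)[OF A])
  have hk: "cmod (h w) \<le> k" if "w \<in> ?S" for w
  proof -
    have "cmod (h w) = cmod (f w) / cmod (\<phi> f)"
      using that by (simp add: h_def fun_scale_def scaleC_complex_def norm_mult norm_inverse divide_inverse)
    then show ?thesis
      using norm_le_sup_norm[OF function_algebraD(3)[OF A f] that] by (simp add: k_def divide_right_mono)
  qed
  have GA: "G g \<in> A" if "g \<in> A" for g
    unfolding G_def by (intro function_algebraD[OF A] h that)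
  have clos: "closedin (mtopology_of ?m) A"
    using function_algebraD(1)[OF A] by (simp add: closed_subspace_def)
  \<comment> \<open>The fixed point is sought in \<open>A\<close> itself, complete as a closed
    subset of the bounded continuous functions, because multiplicativity of \<open>\<phi>\<close> is
    available only there.\<close>
  interpret Submetric "mspace ?m" "mdist ?m" A
    using closedin_subset[OF clos]
    by (simp add: Submetric_def Submetric_axioms_def del: mspace_cfunspace)
  have "sub.mcomplete"
    using clos mcomplete_cfunspace_euclidean[of \<Omega>, where 'v = complex]
    by (intro closedin_mcomplete_imp_mcomplete)
      (auto simp: mtopology_of_def mcomplete_of_def simp del: mspace_cfunspace)
  moreover have "mdist ?m (G u) (G v) \<le> k * mdist ?m u v" if uv: "u \<in> A" "v \<in> A" for u v
  proof -
    have dist: "mdist ?m a b = sup_norm ?S (\<lambda>s\<in>?S. a s - b s)" if "a \<in> A" "b \<in> A" for a b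
    proof -
      have "a \<in> mspace (funspace ?S euclidean_metric)" "b \<in> mspace (funspace ?S euclidean_metric)"
        using subset that cfunspace_subset_funspace by blast+
      then show ?thesis
        unfolding mdist_cfunspace_eq_mdist_funspace by (rule mdist_funspace_eq_sup_norm)
    qed
    have bdd: "bounded ((\<lambda>s\<in>?S. u s - v s) ` ?S)"
      using function_algebraD(3)[OF A closed_subspace_diff[OF function_algebraD(1)[OF A] uv]]
      by (simp add: fun_diff_eq)
    have "sup_norm ?S (\<lambda>s\<in>?S. G u s - G v s) \<le> k * sup_norm ?S (\<lambda>s\<in>?S. u s - v s)"
    proof (rule sup_norm_le)
      show "0 \<le> k * sup_norm ?S (\<lambda>s\<in>?S. u s - v s)"
        using k sup_norm_nonneg[OF bdd] by simp
      fix w assume w: "w \<in> ?S"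
      \<comment> \<open>The constant \<open>1\<close> cancels in \<open>G u - G v\<close>, leaving
        \<open>h\<close> times \<open>u - v\<close>.\<close>
      have "cmod (G u w - G v w) = cmod (h w) * cmod (u w - v w)"
        using w by (simp add: G_def fun_add_def fun_mult_def scaleC_complex_def
            flip: norm_mult right_diff_distrib)
      also have "\<dots> \<le> k * sup_norm ?S (\<lambda>s\<in>?S. u s - v s)"
        using norm_le_sup_norm[OF bdd w] w by (intro mult_mono hk k) auto
      finally show "cmod ((\<lambda>s\<in>?S. G u s - G v s) w) \<le> k * sup_norm ?S (\<lambda>s\<in>?S. u s - v s)"
        using w by simp
    qed
    then show ?thesis using uv GA by (simp add: dist)
  qed
  ultimately obtain g where g: "g \<in> A" "G g = g"
    using sub.Banach_fixedpoint_thm[of G k] GA k f by blast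
  have "\<phi> (G g) = 1 + \<phi> g"
    unfolding G_def using g h
    by (simp add: charactersD[OF \<phi>] function_algebraD[OF A] character_const[OF A \<phi>])
  with g show False by simp
qed

text \<open>Sends the points of \<open>\<Omega>\<close> to characters; these evaluations give the
  lower norm bounds for both transforms. The constant \<open>1\<close> shows that an evaluation is
  nonzero.\<close>

lemma evaluation_character:
  assumes A: "function_algebra \<Omega> A" and w: "w \<in> topspace \<Omega>"
  shows "(\<lambda>f\<in>A. f w) \<in> characters \<Omega> A"
proof -
  have "\<exists>f\<in>A. f w \<noteq> 0"
    using function_algebraD(7)[OF A, of 1] w by (intro bexI) auto
  then show ?thesis
    using w by (auto simp: characters_def function_algebraD[OF A])
      (auto simp: fun_add_def fun_scale_def fun_mult_def scaleC_complex_def)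
qed

section \<open>Topology of the maximal ideal space\<close>

lemma continuous_map_maximal_ideal_space:
  assumes "f \<in> A"
  shows "continuous_map (maximal_ideal_space \<Omega> A) euclidean (\<lambda>\<phi>. \<phi> f)"
  unfolding maximal_ideal_space_def using assms
  by (intro continuous_map_from_subtopology continuous_map_product_projection)

lemma Hausdorff_maximal_ideal_space: "Hausdorff_space (maximal_ideal_space \<Omega> A)"
  unfolding maximal_ideal_space_def
  by (intro Hausdorff_space_subtopology) (simp add: Hausdorff_space_product_topology)

lemma closedin_Collect_ball:
  assumes "\<And>i. i \<in> I \<Longrightarrow> closedin X {x \<in> topspace X. P i x}"
  shows "closedin X {x \<in> topspace X. \<forall>i\<in>I. P i x}"
proof (cases "I = {}")
  case False
  then have "{x \<in> topspace X. \<forall>i\<in>I. P i x} = (\<Inter>i\<in>I. {x \<in> topspace X. P i x})"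
    by auto
  then show ?thesis
    using assms False by (auto intro: closedin_Inter)
qed simp

text \<open>The algebraic conditions are equations between continuous functions of
  \<open>\<phi>\<close>, hence closed. Being nonzero is an open condition; given the others it
  amounts to \<open>\<phi> 1 = 1\<close>, which is closed.\<close>

lemma closedin_characters:
  assumes A: "function_algebra \<Omega> A"
  shows "closedin (product_topology (\<lambda>_. euclidean) A) (characters \<Omega> A)"
proof -
  let ?S = "topspace \<Omega>" and ?P = "product_topology (\<lambda>_. euclidean) A :: (('a \<Rightarrow> complex) \<Rightarrow> complex) topology"
  let ?one = "\<lambda>w\<in>?S. 1 :: complex"
  have proj: "continuous_map ?P euclidean (\<lambda>\<phi>. \<phi> f)" if "f \<in> A" for f
    using that by (rule continuous_map_product_projection)
  have mult: "continuous_map ?P euclidean (\<lambda>\<phi>. u \<phi> * v \<phi>)"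
    if "continuous_map ?P euclidean u" "continuous_map ?P euclidean v" for u v :: "_ \<Rightarrow> complex"
    using that by (simp add: continuous_map_atin tendsto_mult)
  have eq: "closedin ?P {\<phi> \<in> topspace ?P. u \<phi> = v \<phi>}"
    if "continuous_map ?P euclidean u" "continuous_map ?P euclidean v" for u v :: "_ \<Rightarrow> complex"
    using that by (intro closedin_continuous_maps_eq[where Y = euclidean]) auto
  have "characters \<Omega> A = {\<phi> \<in> topspace ?P. \<phi> ?one = 1}
    \<inter> {\<phi> \<in> topspace ?P. \<forall>f\<in>A. \<forall>g\<in>A. \<phi> (fun_add ?S f g) = \<phi> f + \<phi> g}
    \<inter> {\<phi> \<in> topspace ?P. \<forall>c\<in>UNIV. \<forall>f\<in>A. \<phi> (fun_scale ?S c f) = c * \<phi> f}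
    \<inter> {\<phi> \<in> topspace ?P. \<forall>f\<in>A. \<forall>g\<in>A. \<phi> (fun_mult ?S f g) = \<phi> f * \<phi> g}"
    (is "_ = ?R")
  proof
    show "characters \<Omega> A \<subseteq> ?R"
      using character_const[OF A] by (auto simp: characters_def PiE_def)
    have "\<phi> \<in> characters \<Omega> A" if "\<phi> \<in> ?R" for \<phi>
    proof -
      have "\<exists>f\<in>A. \<phi> f \<noteq> 0"
        using that function_algebraD(7)[OF A, of 1] by (intro bexI[of _ ?one]) auto
      with that show ?thesis by (simp add: characters_def PiE_def)
    qed
    then show "?R \<subseteq> characters \<Omega> A" by blast
  qed
  moreover have "closedin ?P ?R"
    using function_algebraD(4-7)[OF A]
    by (intro closedin_Int closedin_Collect_ball eq continuous_map_add mult proj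
        continuous_map_const[THEN iffD2]) auto
  ultimately show ?thesis by simp
qed

text \<open>The Banach-Alaoglu argument: contractivity puts the characters into a product of closed
  discs, compact by Tychonoff, and they form a closed set.\<close>

lemma compact_maximal_ideal_space:
  assumes A: "function_algebra \<Omega> A"
  shows "compact_space (maximal_ideal_space \<Omega> A)"
proof -
  let ?K = "PiE A (\<lambda>f. cball (0 :: complex) (sup_norm (topspace \<Omega>) f))"
  have "compactin (product_topology (\<lambda>_. euclidean) A) ?K"
    by (simp add: compactin_PiE)
  moreover have "characters \<Omega> A \<subseteq> ?K"
  proof
    fix \<phi> assume \<phi>: "\<phi> \<in> characters \<Omega> A"
    then have "\<phi> \<in> extensional A" by (simp add: characters_def)
    then show "\<phi> \<in> ?K"
      using character_le_sup_norm[OF A \<phi>] by (auto simp: PiE_iff)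
  qed
  ultimately show ?thesis
    unfolding maximal_ideal_space_def
    using closed_compactin closedin_characters[OF A] compact_space_subtopology by metis
qed

section \<open>The scalar Gelfand transform\<close>

lemma bounded_function_algebra_characters:
  assumes "function_algebra \<Omega> A" "f \<in> A"
  shows "bounded ((\<lambda>\<phi>. \<phi> f) ` characters \<Omega> A)"
  using character_le_sup_norm[OF assms(1) _ assms(2)] by (auto simp: bounded_iff)

text \<open>The upper bound is contractivity of characters; for the lower one, \<open>f w\<close> is
  the value of the transform at the evaluation at \<open>w\<close>.\<close>

lemma sup_norm_gelfand_transform:
  assumes A: "function_algebra \<Omega> A" and f: "f \<in> A"
  shows "sup_norm (characters \<Omega> A) (gelfand_transform \<Omega> A f) = sup_norm (topspace \<Omega>) f"
proof (rule antisym)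
  show "sup_norm (characters \<Omega> A) (gelfand_transform \<Omega> A f) \<le> sup_norm (topspace \<Omega>) f"
    using character_le_sup_norm[OF A _ f] sup_norm_nonneg[OF function_algebraD(3)[OF A f]]
    by (intro sup_norm_le) (auto simp: gelfand_transform_def)
  have bdd: "bounded (gelfand_transform \<Omega> A f ` characters \<Omega> A)"
    using bounded_function_algebra_characters[OF A f] by (simp add: gelfand_transform_def)
  show "sup_norm (topspace \<Omega>) f \<le> sup_norm (characters \<Omega> A) (gelfand_transform \<Omega> A f)"
  proof (rule sup_norm_le)
    fix w assume w: "w \<in> topspace \<Omega>"
    show "cmod (f w) \<le> sup_norm (characters \<Omega> A) (gelfand_transform \<Omega> A f)"
      using norm_le_sup_norm[OF bdd evaluation_character[OF A w]] f evaluation_character[OF A w]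
      by (simp add: gelfand_transform_def)
  qed (rule sup_norm_nonneg[OF bdd])
qed

text \<open>The isometry makes the image closed; products and constants carry over because
  characters are multiplicative and unital. Distinct characters differ at some \<open>f\<close> in
  \<open>A\<close>, being extensional on \<open>A\<close>, so the transforms separate them.\<close>

lemma uniform_algebra_gelfand_transform:
  assumes A: "function_algebra \<Omega> A"
  shows "uniform_algebra (maximal_ideal_space \<Omega> A) (gelfand_transform \<Omega> A ` A)"
proof -
  let ?M = "maximal_ideal_space \<Omega> A" and ?T = "gelfand_transform \<Omega> A"
  have "closed_subspace (topspace ?M) (cfunspace ?M euclidean_metric) (?T ` A)"
  proof (rule closed_subspace_isometric_image_cfunspace(1)[OF function_algebraD(1)[OF A]
        cfunspace_subset_funspace mdist_cfunspace_eq_mdist_funspace])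
    fix f assume f: "f \<in> A"
    have "continuous_map ?M euclidean (?T f)"
      using continuous_map_maximal_ideal_space[OF f, of \<Omega>]
      by (rule continuous_map_eq) (simp add: gelfand_transform_def topspace_maximal_ideal_space)
    moreover have "bounded (?T f ` characters \<Omega> A)"
      using bounded_function_algebra_characters[OF A f] by (simp add: gelfand_transform_def)
    ultimately show "?T f \<in> mspace (cfunspace ?M euclidean_metric)"
      unfolding mem_cfunspace_iff
      by (simp add: topspace_maximal_ideal_space gelfand_transform_def)
    show "sup_norm (topspace ?M) (?T f) = sup_norm (topspace \<Omega>) f"
      using sup_norm_gelfand_transform[OF A f] by (simp add: topspace_maximal_ideal_space)
    \<comment> \<open>Unfolding is confined to the operation on
      \<open>characters \<Omega> A\<close>; the one on \<open>topspace \<Omega>\<close> stays folded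
      so that \<open>charactersD\<close> applies.\<close>
    show "?T (fun_scale (topspace \<Omega>) c f) = fun_scale (topspace ?M) c (?T f)" for c
      using f by (auto simp: gelfand_transform_def fun_scale_def[of "characters \<Omega> A"]
          topspace_maximal_ideal_space scaleC_complex_def charactersD)
    show "?T (fun_add (topspace \<Omega>) f g) = fun_add (topspace ?M) (?T f) (?T g)" if "g \<in> A" for g
      using f that by (auto simp: gelfand_transform_def fun_add_def[of "characters \<Omega> A"]
          topspace_maximal_ideal_space charactersD)
  qed
  moreover have "fun_mult (topspace ?M) (?T f) (?T g) \<in> ?T ` A" if "f \<in> A" "g \<in> A" for f g
  proof
    show "fun_mult (topspace ?M) (?T f) (?T g) = ?T (fun_mult (topspace \<Omega>) f g)"
      using that by (auto simp: gelfand_transform_def fun_mult_def[of "characters \<Omega> A"]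
          topspace_maximal_ideal_space scaleC_complex_def charactersD)
  qed (use that function_algebraD(6)[OF A] in blast)
  moreover have "(\<lambda>\<phi>\<in>topspace ?M. c) \<in> ?T ` A" for c
  proof
    show "(\<lambda>\<phi>\<in>topspace ?M. c) = ?T (\<lambda>w\<in>topspace \<Omega>. c)"
      by (auto simp: gelfand_transform_def topspace_maximal_ideal_space character_const[OF A])
  qed (rule function_algebraD(7)[OF A])
  moreover have "\<exists>f\<in>?T ` A. f \<phi> \<noteq> f \<psi>"
    if \<phi>\<psi>: "\<phi> \<in> topspace ?M" "\<psi> \<in> topspace ?M" "\<phi> \<noteq> \<psi>" for \<phi> \<psi>
  proof -
    have "\<phi> \<in> characters \<Omega> A" "\<psi> \<in> characters \<Omega> A"
      using \<phi>\<psi> by (auto simp: topspace_maximal_ideal_space)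
    moreover from this have "\<phi> \<in> extensional A" "\<psi> \<in> extensional A"
      by (auto simp: characters_def)
    then obtain f where "f \<in> A" "\<phi> f \<noteq> \<psi> f"
      using \<phi>\<psi>(3) extensionalityI by blast
    ultimately show ?thesis by (auto simp: gelfand_transform_def)
  qed
  ultimately show ?thesis
    by (simp add: uniform_algebra_def function_algebra_def compact_maximal_ideal_space[OF A]
        Hausdorff_maximal_ideal_space)
qed


section \<open>The transform of a vector-valued function space\<close>

text \<open>The extensional form of \<open>x' \<circ> f\<close>; the elements of
  \<open>base_algebra\<close> are exactly of this kind.\<close>

definition fun_comp :: "'w set \<Rightarrow> 'x::complex_normed_vector cdual \<Rightarrow> ('w \<Rightarrow> 'x) \<Rightarrow> 'w \<Rightarrow> complex"
  where "fun_comp S x' f = (\<lambda>w\<in>S. cdual_apply x' (f w))"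

definition vector_gelfand_transform ::
    "'w topology \<Rightarrow> ('w \<Rightarrow> complex) set \<Rightarrow> ('w \<Rightarrow> 'x) \<Rightarrow>
     (('w \<Rightarrow> complex) \<Rightarrow> complex) \<Rightarrow> 'x::complex_normed_vector cdual cdual"
  where "vector_gelfand_transform \<Omega> A f =
    (\<lambda>\<phi>\<in>characters \<Omega> A. cdual_of (\<lambda>x'. \<phi> (fun_comp (topspace \<Omega>) x' f)))"

text \<open>Linearity in \<open>x'\<close> puts the values of the transform in the bidual; the laws
  in \<open>f\<close> below make the transform linear and compatible with multiplication by
  \<open>A\<close>.\<close>

lemma fun_comp_add_left: "fun_comp S (x' + y') f = fun_add S (fun_comp S x' f) (fun_comp S y' f)"
  by (auto simp: fun_comp_def fun_add_def cdual_apply_add_left)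

lemma fun_comp_scaleC_left: "fun_comp S (c *\<^sub>C x') f = fun_scale S c (fun_comp S x' f)"
  by (auto simp: fun_comp_def fun_scale_def cdual_apply_scaleC_left scaleC_complex_def)

lemma fun_comp_fun_add: "fun_comp S x' (fun_add S f g) = fun_add S (fun_comp S x' f) (fun_comp S x' g)"
  by (auto simp: fun_comp_def fun_add_def cdual_apply_add)

lemma fun_comp_fun_scale: "fun_comp S x' (fun_scale S c f) = fun_scale S c (fun_comp S x' f)"
  by (auto simp: fun_comp_def fun_scale_def cdual_apply_scaleC scaleC_complex_def)

lemma fun_comp_fun_mult: "fun_comp S x' (fun_mult S \<phi> f) = fun_mult S \<phi> (fun_comp S x' f)"
  by (auto simp: fun_comp_def fun_mult_def cdual_apply_scaleC scaleC_complex_def)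

lemma sup_norm_fun_comp_le:
  assumes "bounded (f ` S)"
  shows "sup_norm S (fun_comp S x' f) \<le> sup_norm S f * norm x'"
proof (rule sup_norm_le)
  show "0 \<le> sup_norm S f * norm x'"
    using sup_norm_nonneg[OF assms] by simp
  fix w assume w: "w \<in> S"
  have "cmod (cdual_apply x' (f w)) \<le> norm x' * norm (f w)"
    by (rule norm_cdual_apply_le)
  also have "\<dots> \<le> norm x' * sup_norm S f"
    using norm_le_sup_norm[OF assms w] by (intro mult_left_mono) auto
  finally show "norm (fun_comp S x' f w) \<le> sup_norm S f * norm x'"
    using w by (simp add: fun_comp_def mult.commute)
qed

lemma function_spaceD:
  assumes "function_space \<Omega> A F"
  shows "closed_subspace (topspace \<Omega>) (cfunspace \<Omega> euclidean_metric) F"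
    and "function_algebra \<Omega> A"
    and "f \<in> F \<Longrightarrow> bounded (f ` topspace \<Omega>)"
    and "f \<in> F \<Longrightarrow> fun_comp (topspace \<Omega>) x' f \<in> A"
    and "a \<in> A \<Longrightarrow> \<exists>x'. \<exists>f\<in>F. a = fun_comp (topspace \<Omega>) x' f"
    and "a \<in> A \<Longrightarrow> f \<in> F \<Longrightarrow> fun_mult (topspace \<Omega>) a f \<in> F"
proof -
  show cs: "closed_subspace (topspace \<Omega>) (cfunspace \<Omega> euclidean_metric) F"
    using assms by (simp add: function_space_def)
  then have "F \<subseteq> mspace (cfunspace \<Omega> euclidean_metric)"
    using closedin_subset by (fastforce simp: closed_subspace_def simp del: mspace_cfunspace)
  then show "f \<in> F \<Longrightarrow> bounded (f ` topspace \<Omega>)"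
    by (auto simp: mem_cfunspace_iff simp del: mspace_cfunspace)
qed (use assms in \<open>auto simp: function_space_def base_algebra_def fun_comp_def\<close>)

text \<open>Contractivity of \<open>\<phi>\<close> bounds the functional by
  \<open>sup_norm (topspace \<Omega>) f * norm x'\<close>, so \<open>cdual_of\<close> acts as
  intended. Later proofs reach the values of the transform through this equation.\<close>

lemma vector_gelfand_transform_apply:
  assumes F: "function_space \<Omega> A F" and f: "f \<in> F" and \<phi>: "\<phi> \<in> characters \<Omega> A"
  shows "cdual_apply (vector_gelfand_transform \<Omega> A f \<phi>) x' = \<phi> (fun_comp (topspace \<Omega>) x' f)"
proof -
  have "cdual_apply (cdual_of (\<lambda>x'. \<phi> (fun_comp (topspace \<Omega>) x' f))) =
      (\<lambda>x'. \<phi> (fun_comp (topspace \<Omega>) x' f))"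
  proof (rule cdual_apply_cdual_of)
    show "cmod (\<phi> (fun_comp (topspace \<Omega>) x' f)) \<le> sup_norm (topspace \<Omega>) f * norm x'" for x'
      using character_le_sup_norm[OF function_spaceD(2)[OF F] \<phi> function_spaceD(4)[OF F f]]
        sup_norm_fun_comp_le[OF function_spaceD(3)[OF F f]] by (rule order_trans)
  qed (simp_all add: fun_comp_add_left fun_comp_scaleC_left charactersD[OF \<phi>] function_spaceD(4)[OF F f])
  with \<phi> show ?thesis by (simp add: vector_gelfand_transform_def)
qed

lemma norm_vector_gelfand_transform_le:
  assumes F: "function_space \<Omega> A F" and f: "f \<in> F" and \<phi>: "\<phi> \<in> characters \<Omega> A"
  shows "norm (vector_gelfand_transform \<Omega> A f \<phi>) \<le> sup_norm (topspace \<Omega>) f"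
proof (rule norm_cdual_bound)
  show "0 \<le> sup_norm (topspace \<Omega>) f"
    using function_spaceD(3)[OF F f] by (rule sup_norm_nonneg)
  show "cmod (cdual_apply (vector_gelfand_transform \<Omega> A f \<phi>) x') \<le> sup_norm (topspace \<Omega>) f * norm x'" for x'
    unfolding vector_gelfand_transform_apply[OF assms]
    using character_le_sup_norm[OF function_spaceD(2)[OF F] \<phi> function_spaceD(4)[OF F f]]
      sup_norm_fun_comp_le[OF function_spaceD(3)[OF F f]] by (rule order_trans)
qed

lemma bounded_vector_gelfand_transform:
  assumes "function_space \<Omega> A F" "f \<in> F"
  shows "bounded (vector_gelfand_transform \<Omega> A f ` characters \<Omega> A)"
  using norm_vector_gelfand_transform_le[OF assms] by (auto simp: bounded_iff)

lemma sup_norm_vector_gelfand_transform: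
  assumes F: "function_space \<Omega> A F" and f: "f \<in> F"
  shows "sup_norm (characters \<Omega> A) (vector_gelfand_transform \<Omega> A f) = sup_norm (topspace \<Omega>) f"
proof (rule antisym)
  let ?T = "vector_gelfand_transform \<Omega> A f"
  show "sup_norm (characters \<Omega> A) ?T \<le> sup_norm (topspace \<Omega>) f"
    using norm_vector_gelfand_transform_le[OF F f] sup_norm_nonneg[OF function_spaceD(3)[OF F f]]
    by (intro sup_norm_le) auto
  note bdd = bounded_vector_gelfand_transform[OF F f]
  show "sup_norm (topspace \<Omega>) f \<le> sup_norm (characters \<Omega> A) ?T"
  proof (rule sup_norm_le)
    fix w assume w: "w \<in> topspace \<Omega>"
    let ?e = "\<lambda>a\<in>A. a w"
    have e: "?e \<in> characters \<Omega> A"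
      using function_spaceD(2)[OF F] w by (rule evaluation_character)
    \<comment> \<open>A functional in the dual unit ball, chosen for this \<open>w\<close>, to be
      tested against \<open>?T ?e\<close>, the canonical image of \<open>f w\<close> in the
      bidual.\<close>
    obtain x' where x': "norm x' \<le> 1" "cmod (cdual_apply x' (f w)) = norm (f w)"
      using ex_norming_cdual by blast
    have "cdual_apply (?T ?e) x' = cdual_apply x' (f w)"
      using function_spaceD(4)[OF F f, of x'] w
      by (simp add: vector_gelfand_transform_apply[OF F f e]) (simp add: fun_comp_def)
    then have "norm (f w) \<le> norm (?T ?e) * norm x'"
      using norm_cdual_apply_le[of "?T ?e" x'] x'(2) by simp
    also have "\<dots> \<le> norm (?T ?e) * 1"
      using x'(1) by (intro mult_left_mono) auto
    also have "\<dots> \<le> sup_norm (characters \<Omega> A) ?T"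
      using norm_le_sup_norm[OF bdd e] by simp
    finally show "norm (f w) \<le> sup_norm (characters \<Omega> A) ?T" .
  qed (rule sup_norm_nonneg[OF bdd])
qed

text \<open>Weak-star continuity is tested at each \<open>x'\<close>, where it is continuity of
  \<open>\<phi> \<mapsto> \<phi> (x' \<circ> f)\<close>: a coordinate projection, since
  \<open>x' \<circ> f\<close> lies in \<open>A\<close>.\<close>

lemma vector_gelfand_transform_mem:
  assumes F: "function_space \<Omega> A F" and f: "f \<in> F"
  shows "vector_gelfand_transform \<Omega> A f \<in> mspace (wstar_cfunspace (maximal_ideal_space \<Omega> A))"
proof -
  let ?M = "maximal_ideal_space \<Omega> A"
  have "continuous_map ?M euclidean (\<lambda>\<phi>. cdual_apply (vector_gelfand_transform \<Omega> A f \<phi>) x')" for x'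
    using continuous_map_maximal_ideal_space[OF function_spaceD(4)[OF F f, of x'], of \<Omega>]
    by (rule continuous_map_eq)
      (simp add: vector_gelfand_transform_apply[OF F f] topspace_maximal_ideal_space)
  then show ?thesis
    using bounded_vector_gelfand_transform[OF F f]
    by (simp add: mem_wstar_cfunspace_iff continuous_map_weak_star topspace_maximal_ideal_space)
      (simp add: vector_gelfand_transform_def)
qed

text \<open>Reduces identities of bidual-valued functions to scalar ones, one for each character and
  functional.\<close>

lemma vector_gelfand_transform_eqI:
  assumes F: "function_space \<Omega> A F" and f: "f \<in> F" and h: "h \<in> extensional (characters \<Omega> A)"
    and eq: "\<And>\<phi> x'. \<phi> \<in> characters \<Omega> A \<Longrightarrow> \<phi> (fun_comp (topspace \<Omega>) x' f) = cdual_apply (h \<phi>) x'"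
  shows "vector_gelfand_transform \<Omega> A f = h"
proof (rule extensionalityI[OF _ h])
  show "vector_gelfand_transform \<Omega> A f \<in> extensional (characters \<Omega> A)"
    by (simp add: vector_gelfand_transform_def)
  show "vector_gelfand_transform \<Omega> A f \<phi> = h \<phi>" if "\<phi> \<in> characters \<Omega> A" for \<phi>
    using that by (intro cdual_eqI) (simp add: vector_gelfand_transform_apply[OF F f] eq)
qed

lemma
  assumes F: "function_space \<Omega> A F" and f: "f \<in> F"
  shows vector_gelfand_transform_add: "g \<in> F \<Longrightarrow>
      vector_gelfand_transform \<Omega> A (fun_add (topspace \<Omega>) f g) =
      fun_add (characters \<Omega> A) (vector_gelfand_transform \<Omega> A f) (vector_gelfand_transform \<Omega> A g)"
    and vector_gelfand_transform_scale:
      "vector_gelfand_transform \<Omega> A (fun_scale (topspace \<Omega>) c f) =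
      fun_scale (characters \<Omega> A) c (vector_gelfand_transform \<Omega> A f)"
    and vector_gelfand_transform_mult: "a \<in> A \<Longrightarrow>
      vector_gelfand_transform \<Omega> A (fun_mult (topspace \<Omega>) a f) =
      fun_mult (characters \<Omega> A) (gelfand_transform \<Omega> A a) (vector_gelfand_transform \<Omega> A f)"
proof -
  note app = vector_gelfand_transform_apply[OF F]
  note comp = function_spaceD(4)[OF F]
  have cs: "fun_add (topspace \<Omega>) f g \<in> F" "fun_scale (topspace \<Omega>) c f \<in> F" if "g \<in> F" for g c
    using function_spaceD(1)[OF F] f that by (auto simp: closed_subspace_def)
  show "vector_gelfand_transform \<Omega> A (fun_add (topspace \<Omega>) f g) =
      fun_add (characters \<Omega> A) (vector_gelfand_transform \<Omega> A f) (vector_gelfand_transform \<Omega> A g)"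
    if "g \<in> F"
    using f that
    by (intro vector_gelfand_transform_eqI[OF F] cs)
      (auto simp: fun_comp_fun_add charactersD comp fun_add_def[of "characters \<Omega> A"] app cdual_apply_add_left)
  show "vector_gelfand_transform \<Omega> A (fun_scale (topspace \<Omega>) c f) =
      fun_scale (characters \<Omega> A) c (vector_gelfand_transform \<Omega> A f)"
    using f
    by (intro vector_gelfand_transform_eqI[OF F] cs)
      (auto simp: fun_comp_fun_scale charactersD comp fun_scale_def[of "characters \<Omega> A"] app cdual_apply_scaleC_left)
  \<comment> \<open>Here \<open>x' \<circ> (a f)\<close> is the product of \<open>a\<close> and
    \<open>x' \<circ> f\<close> in \<open>A\<close>, which \<open>\<phi>\<close> sends to
    \<open>\<phi> a * \<phi> (x' \<circ> f)\<close>.\<close>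
  show "vector_gelfand_transform \<Omega> A (fun_mult (topspace \<Omega>) a f) =
      fun_mult (characters \<Omega> A) (gelfand_transform \<Omega> A a) (vector_gelfand_transform \<Omega> A f)"
    if "a \<in> A"
    using f that function_spaceD(6)[OF F that f]
    by (intro vector_gelfand_transform_eqI[OF F])
      (auto simp: fun_comp_fun_mult charactersD comp fun_mult_def[of "characters \<Omega> A"] app
        cdual_apply_scaleC_left gelfand_transform_def)
qed

theorem theorem4p5:
  fixes \<Omega> :: "'w topology"
    and A :: "('w \<Rightarrow> complex) set"
    and F :: "('w \<Rightarrow> 'x::complex_banach) set"
  assumes "\<exists>x::'x. x \<noteq> 0"
    and "Hausdorff_space \<Omega>"
    and "function_space \<Omega> A F"
  shows "\<exists>E :: ((('w \<Rightarrow> complex) \<Rightarrow> complex) \<Rightarrow> 'x cdual cdual) set.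
    wstar_function_space (maximal_ideal_space \<Omega> A) (gelfand_transform \<Omega> A ` A) E \<and>
    isometrically_isomorphic (topspace \<Omega>) F (topspace (maximal_ideal_space \<Omega> A)) E"
proof (intro exI conjI)
  let ?M = "maximal_ideal_space \<Omega> A" and ?S = "topspace \<Omega>"
  let ?T = "vector_gelfand_transform \<Omega> A :: ('w \<Rightarrow> 'x) \<Rightarrow> _"
  note F = assms(3) and M = topspace_maximal_ideal_space[of \<Omega> A]
  note A = function_spaceD(2)[OF F]
  have sub: "mspace (wstar_cfunspace ?M :: (_ \<Rightarrow> 'x cdual cdual) metric)
      \<subseteq> mspace (funspace (topspace ?M) euclidean_metric)"
    and dist: "mdist (wstar_cfunspace ?M :: (_ \<Rightarrow> 'x cdual cdual) metric)
      = mdist (funspace (topspace ?M) euclidean_metric)"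
    by (auto simp: wstar_cfunspace_def)
  have add: "?T (fun_add ?S f g) = fun_add (topspace ?M) (?T f) (?T g)" if "f \<in> F" "g \<in> F" for f g
    using vector_gelfand_transform_add[OF F that] by (simp add: M)
  have scale: "?T (fun_scale ?S c f) = fun_scale (topspace ?M) c (?T f)" if "f \<in> F" for c f
    using vector_gelfand_transform_scale[OF F that] by (simp add: M)
  have iso: "sup_norm (topspace ?M) (?T f) = sup_norm ?S f" if "f \<in> F" for f
    using sup_norm_vector_gelfand_transform[OF F that] by (simp add: M)
  \<comment> \<open>\<open>image(1)\<close> says that the range is a closed subspace,
    \<open>image(2)\<close> that \<open>?T\<close> is injective on \<open>F\<close>.\<close>
  note image = closed_subspace_isometric_image_cfunspace[OF function_spaceD(1)[OF F] sub dist
      vector_gelfand_transform_mem[OF F] add scale iso]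
  \<comment> \<open>Composing \<open>?T f\<close> with \<open>x'\<close> gives the Gelfand transform
    of \<open>x' \<circ> f\<close>, and every element of \<open>A\<close> has the form
    \<open>x' \<circ> f\<close>.\<close>
  have "gelfand_transform \<Omega> A ` A = wstar_base_algebra ?M (?T ` F)"
  proof -
    have eq: "(\<lambda>\<phi>\<in>topspace ?M. cdual_apply (?T f \<phi>) x') = gelfand_transform \<Omega> A (fun_comp ?S x' f)"
      if "f \<in> F" for f x'
      using that by (auto simp: M gelfand_transform_def vector_gelfand_transform_apply[OF F])
    have "wstar_base_algebra ?M (?T ` F) =
        (\<Union>f\<in>F. range (\<lambda>x'. \<lambda>\<phi>\<in>topspace ?M. cdual_apply (?T f \<phi>) x'))"
      unfolding wstar_base_algebra_def by blast
    also have "\<dots> = (\<Union>f\<in>F. range (\<lambda>x'. gelfand_transform \<Omega> A (fun_comp ?S x' f)))"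
      using eq by (intro SUP_cong) simp_all
    also have "\<dots> = gelfand_transform \<Omega> A ` A"
      using function_spaceD(4,5)[OF F] by blast
    finally show ?thesis by simp
  qed
  \<comment> \<open>With \<open>b\<close> coming from \<open>a\<close> and \<open>h\<close> from
    \<open>f\<close>, the product is \<open>?T\<close> of \<open>a\<close> times \<open>f\<close>,
    and \<open>F\<close> is closed under multiplication by \<open>A\<close>.\<close>
  moreover have "fun_mult (topspace ?M) b h \<in> ?T ` F"
    if "b \<in> gelfand_transform \<Omega> A ` A" "h \<in> ?T ` F" for b h
    using that function_spaceD(6)[OF F]
    by (auto simp: M simp flip: vector_gelfand_transform_mult[OF F])
  \<comment> \<open>The range of \<open>?T\<close> is the witness for \<open>E\<close>.\<close>
  ultimately show "wstar_function_space ?M (gelfand_transform \<Omega> A ` A) (?T ` F)"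
    unfolding wstar_function_space_def
    using compact_maximal_ideal_space[OF A] Hausdorff_maximal_ideal_space image(1)
      uniform_algebra_gelfand_transform[OF A] by blast
  show "isometrically_isomorphic ?S F (topspace ?M) (?T ` F)"
    unfolding isometrically_isomorphic_def
    using inj_on_imp_bij_betw[OF image(2)] add scale iso by blast
qed

end
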